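(* Let $a<b$ be real numbers, let $f:[a,b]\to\mathbb{R}$ be a convex Riemann integrable function and let $v\in[0,1]$. Then $$f\left(a\nabla_v b\right)\le R^{(1)}_{f,v}(a,b)\le C_{f,v}(a,b)\le R^{(2)}_{f,v}(a,b)\le f(a)\nabla_v f(b).$$
   Context: For real numbers $x,y$ and $w\in[0,1]$, the weighted arithmetic mean is $x\nabla_w y:=(1-w)x+wy$, and $\nabla:=\nabla_{1/2}$. For $v\in[0,1]$ define $$C_{f,v}(a,b):=\left(\int_0^1 f\left(a\nabla_{vt}b\right)dt\right)\nabla_v\left(\int_0^1 f\left((1-v)(b-a)t+a\nabla_v b\right)dt\right),$$ $$R^{(1)}_{f,v}(a,b):=f\left(a\nabla_{\frac{v}{2}}b\right)\nabla_v f\left(a\nabla_{\frac{1+v}{2}}b\right),\qquad R^{(2)}_{f,v}(a,b):=\left(f(a)\nabla_v f(b)\right)\nabla f\left(a\nabla_v b\right).$$ *)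

theory Defs
  imports "HOL-Analysis.Analysis"
begin

definition weighted_mean :: "real \<Rightarrow> real \<Rightarrow> real \<Rightarrow> real"
    ("(_ \<nabla>\<^bsub>_\<^esub> _)" [66, 0, 66] 65)
  where "x \<nabla>\<^bsub>w\<^esub> y = (1 - w) * x + w * y"

abbreviation midpoint_mean :: "real \<Rightarrow> real \<Rightarrow> real"  (infix "\<nabla>" 65)
  where "x \<nabla> y \<equiv> x \<nabla>\<^bsub>1/2\<^esub> y"

text \<open>
  Riemann integrability in the classical sense: the tagged sums converge as the mesh tends to 0.
  Unlike in the Henstock--Kurzweil definition behind \<open>integrable_on\<close>, the bound on the lengths
  of the subintervals is uniform in the tags. A \<open>tagged_division_of\<close> may contain one-point
  intervals, which contribute 0 to the sum.
\<close>
definition has_riemann_integral :: "(real \<Rightarrow> real) \<Rightarrow> real \<Rightarrow> real \<Rightarrow> real \<Rightarrow> bool"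
  where "has_riemann_integral f a b I \<longleftrightarrow>
    (\<forall>\<epsilon>>0. \<exists>\<delta>>0. \<forall>\<D>. \<D> tagged_division_of {a..b} \<and> (\<forall>(x, K)\<in>\<D>. measure lborel K < \<delta>) \<longrightarrow>
       \<bar>(\<Sum>(x, K)\<in>\<D>. f x * measure lborel K) - I\<bar> < \<epsilon>)"

definition riemann_integrable :: "(real \<Rightarrow> real) \<Rightarrow> real \<Rightarrow> real \<Rightarrow> bool"
  where "riemann_integrable f a b \<longleftrightarrow> (\<exists>I. has_riemann_integral f a b I)"

text \<open>
  The Riemann integral agrees with the library integral wherever it exists, so the integrals
  below are written with the latter.
\<close>
lemma has_riemann_integral_imp_has_integral:
  assumes "has_riemann_integral f a b I"
  shows "(f has_integral I) {a..b}"
proof -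
  have "\<exists>\<gamma>. gauge \<gamma> \<and> (\<forall>\<D>. \<D> tagged_division_of cbox a b \<and> \<gamma> fine \<D> \<longrightarrow>
          norm ((\<Sum>(x, K)\<in>\<D>. measure lborel K *\<^sub>R f x) - I) < \<epsilon>)" if "\<epsilon> > 0" for \<epsilon>
  proof -
    from assms that obtain \<delta> where \<delta>: "\<delta> > 0"
      and sums: "\<forall>\<D>. \<D> tagged_division_of {a..b} \<and> (\<forall>(x, K)\<in>\<D>. measure lborel K < \<delta>) \<longrightarrow>
        \<bar>(\<Sum>(x, K)\<in>\<D>. f x * measure lborel K) - I\<bar> < \<epsilon>"
      unfolding has_riemann_integral_def by meson
    have "norm ((\<Sum>(x, K)\<in>\<D>. measure lborel K *\<^sub>R f x) - I) < \<epsilon>"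
      if \<D>: "\<D> tagged_division_of cbox a b" "(\<lambda>x. ball x (\<delta>/2)) fine \<D>" for \<D>
    proof -
      have "measure lborel K < \<delta>" if "(x, K) \<in> \<D>" for x K
      proof -
        obtain u w where K: "K = {u..w}" and "x \<in> K"
          using \<D>(1) \<open>(x, K) \<in> \<D>\<close> by (metis box_real(2) tagged_division_ofD(2,4))
        have "K \<subseteq> ball x (\<delta>/2)"
          using \<D>(2) \<open>(x, K) \<in> \<D>\<close> by (auto simp: fine_def)
        moreover have "u \<in> K" "w \<in> K" "u \<le> w"
          using K \<open>x \<in> K\<close> by auto
        ultimately have "u \<in> ball x (\<delta>/2)" "w \<in> ball x (\<delta>/2)" "u \<le> w"
          by blast+
        moreover have "w - u \<le> \<bar>x - u\<bar> + \<bar>x - w\<bar>"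
          by linarith
        ultimately show ?thesis
          unfolding K by (simp add: dist_real_def)
      qed
      then show ?thesis
        using sums[rule_format, of \<D>] \<D>(1) by (auto simp: mult.commute)
    qed
    moreover have "gauge (\<lambda>x::real. ball x (\<delta>/2))" using \<delta> by (intro gauge_ball) simp
    ultimately show ?thesis by blast
  qed
  then show ?thesis by (simp add: has_integral flip: box_real(2))
qed

definition C_mean :: "(real \<Rightarrow> real) \<Rightarrow> real \<Rightarrow> real \<Rightarrow> real \<Rightarrow> real"
  where "C_mean f v a b =
    (integral {0..1} (\<lambda>t. f (a \<nabla>\<^bsub>v * t\<^esub> b)))
      \<nabla>\<^bsub>v\<^esub> (integral {0..1} (\<lambda>t. f ((1 - v) * (b - a) * t + (a \<nabla>\<^bsub>v\<^esub> b))))"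

definition R1_mean :: "(real \<Rightarrow> real) \<Rightarrow> real \<Rightarrow> real \<Rightarrow> real \<Rightarrow> real"
  where "R1_mean f v a b = f (a \<nabla>\<^bsub>v / 2\<^esub> b) \<nabla>\<^bsub>v\<^esub> f (a \<nabla>\<^bsub>(1 + v) / 2\<^esub> b)"

definition R2_mean :: "(real \<Rightarrow> real) \<Rightarrow> real \<Rightarrow> real \<Rightarrow> real \<Rightarrow> real"
  where "R2_mean f v a b = (f a \<nabla>\<^bsub>v\<^esub> f b) \<nabla> f (a \<nabla>\<^bsub>v\<^esub> b)"

end

theory Submission
  imports Defs
begin

text \<open>
  Put \<open>m = a \<nabla>\<^bsub>v\<^esub> b\<close>. The two integrals in \<open>C_mean\<close> are the average values of \<open>f\<close> on
  the segments \<open>[a, m]\<close> and \<open>[m, b]\<close>, the arguments of \<open>f\<close> in \<open>R1_mean\<close> are the midpoints of these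
  segments, and \<open>R2_mean\<close> is the \<open>v\<close>-weighted mean of \<open>f a \<nabla> f m\<close> and \<open>f m \<nabla> f b\<close>. The two inner
  inequalities are therefore the \<open>v\<close>-weighted means of the Hermite--Hadamard inequality
  (\<open>hermite_hadamard\<close>) on the two segments. The outer inequalities come straight from convexity:
  on the left because \<open>m\<close> is the \<open>v\<close>-weighted mean of the two midpoints, on the right because
  \<open>f m \<le> f a \<nabla>\<^bsub>v\<^esub> f b\<close>.
\<close>

lemma weighted_mean_mono:
  assumes "w \<in> {0..1}" "x \<le> x'" "y \<le> y'"
  shows "x \<nabla>\<^bsub>w\<^esub> y \<le> x' \<nabla>\<^bsub>w\<^esub> y'"
  using assms unfolding weighted_mean_def by (intro add_mono mult_left_mono) auto

lemma weighted_mean_between: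
  assumes "w \<in> {0..1}" "x \<le> y"
  shows "x \<nabla>\<^bsub>w\<^esub> y \<in> {x..y}"
  using weighted_mean_mono[OF assms(1), of x x x y] weighted_mean_mono[OF assms(1), of x y y y] assms(2)
  by (simp add: weighted_mean_def algebra_simps)

lemma convex_on_weighted_mean:
  assumes "convex_on S f" "w \<in> {0..1}" "x \<in> S" "y \<in> S"
  shows "f (x \<nabla>\<^bsub>w\<^esub> y) \<le> f x \<nabla>\<^bsub>w\<^esub> f y"
  using convex_onD[OF assms(1), of w x y] assms by (simp add: weighted_mean_def)

text \<open>
  The degenerate segment \<open>c = d\<close>, for which the affine substitution breaks down, does occur:
  for \<open>v = 0\<close> or \<open>v = 1\<close> one of the segments \<open>[a, m]\<close> and \<open>[m, b]\<close> is a point.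
\<close>
lemma integrable_on_segment:
  assumes "f integrable_on {c..d}" "c \<le> d"
  shows "(\<lambda>t. f (c \<nabla>\<^bsub>t\<^esub> d)) integrable_on {0..1}"
proof (cases "c = d")
  case True
  then show ?thesis
    using integrable_const_ivl[of "f d" 0 "1::real"] by (simp add: weighted_mean_def algebra_simps)
next
  case False
  with assms(2) have "c < d" by simp
  obtain I where "(f has_integral I) (cbox c d)"
    using assms(1) by auto
  from has_integral_affinity[OF this, of "d - c" c] \<open>c < d\<close>
  have "(\<lambda>t. f ((d - c) * t + c)) integrable_on (\<lambda>x. (x - c) / (d - c)) ` {c..d}"
    by (auto simp: integrable_on_def image_affinity_cbox divide_simps)
  moreover have "(\<lambda>x. (x - c) / (d - c)) ` {c..d} = {0..1}"
    using \<open>c < d\<close> image_affinity_atLeastAtMost_div_diff[of "d - c" "c / (d - c)" c d]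
      diff_divide_distrib[of d c "d - c"] by (simp add: diff_divide_distrib[symmetric])
  ultimately show ?thesis
    by (simp add: weighted_mean_def algebra_simps)
qed

lemma has_integral_flip_unit_interval:
  fixes g :: "real \<Rightarrow> real"
  assumes "(g has_integral I) {0..1}"
  shows "((\<lambda>t. g (1 - t)) has_integral I) {0..1}"
  using has_integral_affinity[of g I 0 1 "-1" 1] assms by simp

text \<open>
  Averaging the integrand with its reflection \<open>t \<mapsto> 1 - t\<close> does not change the integral.
  The points \<open>c \<nabla>\<^bsub>t\<^esub> d\<close> and \<open>c \<nabla>\<^bsub>1 - t\<^esub> d\<close> are symmetric about the midpoint \<open>c \<nabla> d\<close>,
  so convexity bounds the averaged integrand below by \<open>f (c \<nabla> d)\<close> at every \<open>t\<close>, and bounding \<open>f\<close>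
  by its chord at both points bounds it above by \<open>f c \<nabla> f d\<close>.
\<close>
lemma hermite_hadamard:
  assumes conv: "convex_on {c..d} f" and int: "f integrable_on {c..d}" and "c \<le> d"
  shows "f (c \<nabla> d) \<le> integral {0..1} (\<lambda>t. f (c \<nabla>\<^bsub>t\<^esub> d))"
    and "integral {0..1} (\<lambda>t. f (c \<nabla>\<^bsub>t\<^esub> d)) \<le> f c \<nabla> f d"
proof -
  define g where "g t = f (c \<nabla>\<^bsub>t\<^esub> d)" for t
  define I where "I = integral {0..1} g"
  have "(g has_integral I) {0..1}"
    using integrable_on_segment[OF int \<open>c \<le> d\<close>] unfolding g_def I_def
    by (rule integrable_integral)
  from has_integral_mult_right[OF has_integral_add[OF this has_integral_flip_unit_interval[OF this]], of "1/2"]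
  have avg: "((\<lambda>t. g t \<nabla> g (1 - t)) has_integral I) {0..1}"
    by (simp add: weighted_mean_def algebra_simps)
  have lower: "f (c \<nabla> d) \<le> g t \<nabla> g (1 - t)" and upper: "g t \<nabla> g (1 - t) \<le> f c \<nabla> f d"
    if t: "t \<in> {0..1}" for t
  proof -
    have t': "1 - t \<in> {0..1}" using t by auto
    have "c \<nabla> d = (c \<nabla>\<^bsub>t\<^esub> d) \<nabla> (c \<nabla>\<^bsub>1 - t\<^esub> d)"
      by (simp add: weighted_mean_def field_simps)
    then show "f (c \<nabla> d) \<le> g t \<nabla> g (1 - t)"
      unfolding g_def using convex_on_weighted_mean[OF conv, of "1/2"]
        weighted_mean_between[OF t \<open>c \<le> d\<close>] weighted_mean_between[OF t' \<open>c \<le> d\<close>] by simp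
    have "g s \<le> f c \<nabla>\<^bsub>s\<^esub> f d" if "s \<in> {0..1}" for s
      unfolding g_def using convex_on_weighted_mean[OF conv that] \<open>c \<le> d\<close> by simp
    then have "g t \<nabla> g (1 - t) \<le> (f c \<nabla>\<^bsub>t\<^esub> f d) \<nabla> (f c \<nabla>\<^bsub>1 - t\<^esub> f d)"
      using t t' by (intro weighted_mean_mono) auto
    also have "\<dots> = f c \<nabla> f d"
      by (simp add: weighted_mean_def field_simps)
    finally show "g t \<nabla> g (1 - t) \<le> f c \<nabla> f d" .
  qed
  have const: "((\<lambda>t. k) has_integral k) {0..1::real}" for k :: real
    using has_integral_const_real[of k 0 1] by simp
  show "f (c \<nabla> d) \<le> integral {0..1} (\<lambda>t. f (c \<nabla>\<^bsub>t\<^esub> d))"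
    using has_integral_le[OF const avg] lower unfolding I_def g_def by simp
  show "integral {0..1} (\<lambda>t. f (c \<nabla>\<^bsub>t\<^esub> d)) \<le> f c \<nabla> f d"
    using has_integral_le[OF avg const] upper unfolding I_def g_def by simp
qed

theorem theorem2p1:
  fixes a b v :: real and f :: "real \<Rightarrow> real"
  assumes "a < b"
    and "convex_on {a..b} f"
    and "riemann_integrable f a b"
    and "v \<in> {0..1}"
  shows "f (a \<nabla>\<^bsub>v\<^esub> b) \<le> R1_mean f v a b
    \<and> R1_mean f v a b \<le> C_mean f v a b
    \<and> C_mean f v a b \<le> R2_mean f v a b
    \<and> R2_mean f v a b \<le> f a \<nabla>\<^bsub>v\<^esub> f b"
proof -
  define m where "m = a \<nabla>\<^bsub>v\<^esub> b"
  have m: "a \<le> m" "m \<le> b"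
    using weighted_mean_between[OF assms(4), of a b] \<open>a < b\<close> by (auto simp: m_def)
  have "f integrable_on {a..b}"
    using assms(3) has_riemann_integral_imp_has_integral
    unfolding riemann_integrable_def by blast
  then have int: "f integrable_on {a..m}" "f integrable_on {m..b}"
    using m by (auto intro: integrable_on_subinterval)
  have conv: "convex_on {a..m} f" "convex_on {m..b} f"
    using m by (auto intro: convex_on_subset[OF assms(2)])
  note left = hermite_hadamard[OF conv(1) int(1) m(1)]
  note right = hermite_hadamard[OF conv(2) int(2) m(2)]
  have R1: "R1_mean f v a b = f (a \<nabla> m) \<nabla>\<^bsub>v\<^esub> f (m \<nabla> b)"
  proof -
    have "a \<nabla>\<^bsub>v / 2\<^esub> b = a \<nabla> m" "a \<nabla>\<^bsub>(1 + v) / 2\<^esub> b = m \<nabla> b"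
      by (simp_all add: weighted_mean_def m_def field_simps)
    then show ?thesis by (simp add: R1_mean_def)
  qed
  have C: "C_mean f v a b = integral {0..1} (\<lambda>t. f (a \<nabla>\<^bsub>t\<^esub> m))
      \<nabla>\<^bsub>v\<^esub> integral {0..1} (\<lambda>t. f (m \<nabla>\<^bsub>t\<^esub> b))"
  proof -
    have "a \<nabla>\<^bsub>v * t\<^esub> b = a \<nabla>\<^bsub>t\<^esub> m" "(1 - v) * (b - a) * t + (a \<nabla>\<^bsub>v\<^esub> b) = m \<nabla>\<^bsub>t\<^esub> b" for t
      by (simp_all add: weighted_mean_def m_def algebra_simps)
    then show ?thesis by (simp add: C_mean_def)
  qed
  have R2: "R2_mean f v a b = (f a \<nabla> f m) \<nabla>\<^bsub>v\<^esub> (f m \<nabla> f b)"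
    unfolding R2_mean_def m_def[symmetric] by (simp add: weighted_mean_def field_simps)
  have "m = (a \<nabla> m) \<nabla>\<^bsub>v\<^esub> (m \<nabla> b)"
    by (simp add: weighted_mean_def m_def field_simps)
  moreover have "a \<nabla> m \<in> {a..b}" "m \<nabla> b \<in> {a..b}"
    using weighted_mean_between[of "1/2" a m] weighted_mean_between[of "1/2" m b] m by auto
  ultimately have "f m \<le> R1_mean f v a b"
    using convex_on_weighted_mean[OF assms(2,4)] unfolding R1 by metis
  moreover have "R1_mean f v a b \<le> C_mean f v a b"
    unfolding R1 C using weighted_mean_mono[OF assms(4) left(1) right(1)] .
  moreover have "C_mean f v a b \<le> R2_mean f v a b"
    unfolding C R2 using weighted_mean_mono[OF assms(4) left(2) right(2)] .
  moreover have "R2_mean f v a b \<le> f a \<nabla>\<^bsub>v\<^esub> f b"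
    using convex_on_weighted_mean[OF assms(2,4), of a b] \<open>a < b\<close>
    unfolding R2_mean_def weighted_mean_def[of _ "1/2"] by simp
  ultimately show ?thesis by (simp add: m_def)
qed

end
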